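(* Let $\beta_{\min}:=\min_{0\le i\le n}\beta_{i+\frac12}>0$. There exists a constant $C$, depending only on $b-a$ and $\beta_{\min}$, such that $$0<G_{ij}\le Ch,\qquad 1\le i,j\le n,$$ and $$|G_{i+1,j}-G_{ij}|\le\frac{h^2}{\beta_{\min}},\qquad 1\le i\le n-1,\ 1\le j\le n.$$ By symmetry of $G$, the same estimate holds for increments in the second index: $$|G_{i,j+1}-G_{ij}|\le\frac{h^2}{\beta_{\min}},\qquad 1\le i\le n,\ 1\le j\le n-1.$$ Moreover, $$\|L_h^{-1}\|_\infty\le\frac{(b-a)^2}{4\beta_{\min}}.$$
   Context: Let $a<b$, let $n\ge 1$ be an integer, $h=(b-a)/(n+1)$, and let $\beta_{i+\frac12}>0$, $i=0,\ldots,n$, be given positive real numbers (face coefficients). $A_h$ is the $n\times n$ tridiagonal matrix acting on $U=(U_1,\ldots,U_n)^T$, with the convention $U_0=U_{n+1}=0$, by $$(A_hU)_i=-\beta_{i-\frac12}U_{i-1}+\left(\beta_{i-\frac12}+\beta_{i+\frac12}\right)U_i-\beta_{i+\frac12}U_{i+1},\qquad 1\le i\le n.$$ Set $L_h:=h^{-2}A_h$ and $G_{ij}:=(L_h^{-1})_{ij}$, $1\le i,j\le n$. $\|\cdot\|_\infty$ denotes the matrix norm induced by the maximum norm (maximum absolute row sum). The constant $C$ does not depend on $n$, $h$, $i$, $j$. *)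

theory Defs
  imports Complex_Main "Jordan_Normal_Form.Gauss_Jordan_Elimination"
begin

definition mesh :: "real \<Rightarrow> real \<Rightarrow> nat \<Rightarrow> real" where
  "mesh a b n = (b - a) / (real n + 1)"

(* The face coefficients are numbered by their integer part: \<beta> i is the
   coefficient at the face i + 1/2, for i = 0, ..., n. *)

definition beta_min :: "nat \<Rightarrow> (nat \<Rightarrow> real) \<Rightarrow> real" where
  "beta_min n \<beta> = Min (\<beta> ` {0..n})"

(* Matrix entries are indexed from 0, so row r belongs to the grid point i = r + 1, whose
   left and right faces i - 1/2 and i + 1/2 carry \<beta> r and \<beta> (r + 1). *)
definition A_mat :: "nat \<Rightarrow> (nat \<Rightarrow> real) \<Rightarrow> real mat" where
  "A_mat n \<beta> = mat n n (\<lambda>(r, c).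
     if c = r then \<beta> r + \<beta> (r + 1)
     else if c + 1 = r then - \<beta> r
     else if c = r + 1 then - \<beta> (r + 1)
     else 0)"

lemma A_mat_action:
  fixes U :: "nat \<Rightarrow> real"
  assumes "U 0 = 0" and "U (n + 1) = 0" and "1 \<le> i" and "i \<le> n"
  shows "(A_mat n \<beta> *\<^sub>v vec n (\<lambda>k. U (k + 1))) $ (i - 1)
    = - \<beta> (i - 1) * U (i - 1) + (\<beta> (i - 1) + \<beta> i) * U i - \<beta> i * U (i + 1)"
proof -
  obtain r where r: "i = Suc r" "r < n" using assms(3,4) by (cases i) auto
  have "(A_mat n \<beta> *\<^sub>v vec n (\<lambda>k. U (k + 1))) $ (i - 1)
      = (\<Sum>c = 0..<n. A_mat n \<beta> $$ (r, c) * U (c + 1))"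
    using r by (simp add: A_mat_def scalar_prod_def)
  also have "\<dots> = (\<Sum>c = 0..<n. (if c = r then (\<beta> r + \<beta> (r + 1)) * U (r + 1) else 0)
      + (if c + 1 = r then - \<beta> r * U r else 0)
      + (if c = r + 1 then - \<beta> (r + 1) * U (r + 2) else 0))"
    using r by (intro sum.cong) (auto simp: A_mat_def)
  also have "\<dots> = (\<Sum>c = 0..<n. if c = r then (\<beta> r + \<beta> (r + 1)) * U (r + 1) else 0)
      + (\<Sum>c = 0..<n. if c + 1 = r then - \<beta> r * U r else 0)
      + (\<Sum>c = 0..<n. if c = r + 1 then - \<beta> (r + 1) * U (r + 2) else 0)"
    by (simp only: sum.distrib)
  also have "(\<Sum>c = 0..<n. if c = r then (\<beta> r + \<beta> (r + 1)) * U (r + 1) else 0)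
      = (\<beta> r + \<beta> (r + 1)) * U (r + 1)"
    using r by (simp add: sum.delta)
  also have "(\<Sum>c = 0..<n. if c + 1 = r then - \<beta> r * U r else 0) = - \<beta> r * U r"
  proof (cases r)
    case 0
    then show ?thesis using assms(1) by simp
  next
    case (Suc s)
    then show ?thesis using r by (simp add: sum.delta)
  qed
  also have "(\<Sum>c = 0..<n. if c = r + 1 then - \<beta> (r + 1) * U (r + 2) else 0)
      = - \<beta> (r + 1) * U (r + 2)"
  proof (cases "r + 1 < n")
    case True
    then show ?thesis by (simp add: sum.delta)
  next
    case False
    then have "r + 2 = n + 1" using r by simp
    then have "U (r + 2) = 0" using assms(2) by simp
    then show ?thesis by (simp add: sum.neutral)
  qed
  finally show ?thesis using r by simp
qed

definition L_mat :: "real \<Rightarrow> real \<Rightarrow> nat \<Rightarrow> (nat \<Rightarrow> real) \<Rightarrow> real mat" where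
  "L_mat a b n \<beta> = (1 / (mesh a b n)\<^sup>2) \<cdot>\<^sub>m A_mat n \<beta>"

(* Meaningful only when L_mat a b n \<beta> is invertible. *)
definition L_inv :: "real \<Rightarrow> real \<Rightarrow> nat \<Rightarrow> (nat \<Rightarrow> real) \<Rightarrow> real mat" where
  "L_inv a b n \<beta> = the (mat_inverse (L_mat a b n \<beta>))"

(* Indices i, j run from 1 to n here. *)
definition G_entry :: "real \<Rightarrow> real \<Rightarrow> nat \<Rightarrow> (nat \<Rightarrow> real) \<Rightarrow> nat \<Rightarrow> nat \<Rightarrow> real" where
  "G_entry a b n \<beta> i j = L_inv a b n \<beta> $$ (i - 1, j - 1)"

(* Both norms are meant for vectors and matrices of positive dimension. *)
definition vec_max_norm :: "real vec \<Rightarrow> real" where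
  "vec_max_norm v = Max ((\<lambda>i. \<bar>v $ i\<bar>) ` {0..<dim_vec v})"

definition mat_inf_norm :: "real mat \<Rightarrow> real" where
  "mat_inf_norm M = (SUP v \<in> carrier_vec (dim_col M) - {0\<^sub>v (dim_col M)}.
     vec_max_norm (M *\<^sub>v v) / vec_max_norm v)"

lemma mat_inf_norm_row_sum:
  assumes M: "M \<in> carrier_mat m n" and "0 < m" and "0 < n"
  shows "mat_inf_norm M = Max ((\<lambda>i. \<Sum>j = 0..<n. \<bar>M $$ (i, j)\<bar>) ` {0..<m})"
    (is "_ = Max (?R ` _)")
proof -
  let ?V = "carrier_vec n - {0\<^sub>v n} :: real vec set"
  let ?q = "\<lambda>v. vec_max_norm (M *\<^sub>v v) / vec_max_norm v"
  have dims: "dim_row M = m" "dim_col M = n" using M by auto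
  have entry: "(M *\<^sub>v v) $ i = (\<Sum>j = 0..<n. M $$ (i, j) * v $ j)"
    if "v \<in> carrier_vec n" "i < m" for v i
    using that dims by (auto simp: scalar_prod_def)
  have le_norm: "\<bar>v $ i\<bar> \<le> vec_max_norm v" if "i < dim_vec v" for v i
    unfolding vec_max_norm_def using that by (intro Max_ge) auto
  have pos: "0 < vec_max_norm v" if v: "v \<in> ?V" for v
  proof -
    have "\<exists>i<n. v $ i \<noteq> 0"
    proof (rule ccontr)
      assume "\<not> ?thesis"
      then have "v = 0\<^sub>v n" using v by (intro eq_vecI) auto
      then show False using v by simp
    qed
    then obtain i where i: "i < n" "v $ i \<noteq> 0" by blast
    then have "0 < \<bar>v $ i\<bar>" by simp
    also have "\<dots> \<le> vec_max_norm v" using i v by (intro le_norm) auto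
    finally show ?thesis .
  qed
  have upper: "?q v \<le> Max (?R ` {0..<m})" if v: "v \<in> ?V" for v
  proof -
    have vc: "v \<in> carrier_vec n" using v by simp
    have "\<bar>(M *\<^sub>v v) $ i\<bar> \<le> Max (?R ` {0..<m}) * vec_max_norm v" if i: "i < m" for i
    proof -
      have "\<bar>(M *\<^sub>v v) $ i\<bar> \<le> (\<Sum>j = 0..<n. \<bar>M $$ (i, j) * v $ j\<bar>)"
        unfolding entry[OF vc i] by (rule sum_abs)
      also have "\<dots> \<le> (\<Sum>j = 0..<n. \<bar>M $$ (i, j)\<bar> * vec_max_norm v)"
        using vc by (intro sum_mono) (auto simp: abs_mult intro!: mult_left_mono le_norm)
      also have "\<dots> = ?R i * vec_max_norm v" by (simp add: sum_distrib_right)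
      also have "\<dots> \<le> Max (?R ` {0..<m}) * vec_max_norm v"
        using i pos[OF v] by (intro mult_right_mono Max_ge) auto
      finally show ?thesis .
    qed
    then have "vec_max_norm (M *\<^sub>v v) \<le> Max (?R ` {0..<m}) * vec_max_norm v"
      unfolding vec_max_norm_def[of "M *\<^sub>v v"] using dims \<open>0 < m\<close>
      by (intro Max.boundedI) auto
    then show ?thesis using pos[OF v] by (simp add: divide_le_eq)
  qed
  have "Max (?R ` {0..<m}) \<in> ?R ` {0..<m}" using \<open>0 < m\<close> by (intro Max_in) auto
  then obtain k where k: "k < m" "Max (?R ` {0..<m}) = ?R k" by auto
  define w where "w = vec n (\<lambda>j. if M $$ (k, j) < 0 then - 1 else (1::real))"
  have wc: "w \<in> carrier_vec n" by (simp add: w_def)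
  have w1: "vec_max_norm w = 1"
  proof -
    have "(\<lambda>i. \<bar>w $ i\<bar>) ` {0..<dim_vec w} = {1}"
      using \<open>0 < n\<close> by (auto simp: w_def image_iff)
    then show ?thesis by (simp add: vec_max_norm_def)
  qed
  have wV: "w \<in> ?V"
  proof -
    have "w $ 0 \<noteq> 0" using \<open>0 < n\<close> by (simp add: w_def)
    then have "w \<noteq> 0\<^sub>v n" using \<open>0 < n\<close> by (metis index_zero_vec(1))
    then show ?thesis using wc by simp
  qed
  have "?R k = (M *\<^sub>v w) $ k"
    unfolding entry[OF wc k(1)] by (intro sum.cong) (auto simp: w_def)
  also have "\<dots> \<le> \<bar>(M *\<^sub>v w) $ k\<bar>" by simp
  also have "\<dots> \<le> vec_max_norm (M *\<^sub>v w)" using k dims by (intro le_norm) simp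
  finally have lower: "Max (?R ` {0..<m}) \<le> ?q w" using k w1 by simp
  have "Sup (?q ` ?V) = Max (?R ` {0..<m})"
  proof (rule antisym)
    show "Sup (?q ` ?V) \<le> Max (?R ` {0..<m})"
      using wV upper by (intro cSUP_least) auto
    have "?q w \<le> Sup (?q ` ?V)"
      using wV upper by (intro cSUP_upper) (auto intro!: bdd_aboveI2)
    then show "Max (?R ` {0..<m}) \<le> Sup (?q ` ?V)" using lower by simp
  qed
  then show ?thesis by (simp add: mat_inf_norm_def dims)
qed

end

theory Submission
  imports Defs "Jordan_Normal_Form.Determinant"
begin

text \<open>
  The operator \<open>L\<^sub>h\<close> discretises \<open>-(\<beta> u')'\<close> with zero boundary values, and, as for the
  differential operator, its Green function is explicit: read \<open>1 / \<beta> k\<close> as the resistance of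
  the face \<open>k\<close> and let \<open>S i\<close> be the total resistance to the left of the grid point \<open>i\<close>, with
  \<open>T = S (n + 1)\<close>; then \<open>G\<close> is \<open>h\<^sup>2\<close> times
  \<open>g i j = S (min i j) * (T - S (max i j)) / T\<close>. The reason is that the
  flux \<open>\<beta> k * (g (k + 1) j - g k j)\<close> of this function, as \<open>k\<close> varies with \<open>j\<close>
  fixed, is the constant \<open>(T - S j) / T\<close> to the left of \<open>j\<close> and the constant \<open>- S j / T\<close> to the
  right; it drops by exactly one at \<open>j\<close> (lemma \<open>green_flux\<close>), and \<open>A\<^sub>h\<close> computes such drops.

  All estimates can be read off. Both flux values have modulus at most one, so one increment
  of \<open>g\<close> is at most \<open>1 / \<beta> k\<close>. Moreover \<open>S\<close> increases, so
  \<open>g i j \<le> S m * (T - S m) / T \<le> T / 4\<close> with \<open>m = max i j\<close>, and \<open>T \<le> (n + 1) / beta_min\<close>; hence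
  \<open>G \<le> h * (b - a) / (4 * beta_min)\<close>. A row has \<open>n\<close> entries and \<open>n * h \<le> b - a\<close>, which
  turns the remaining factor \<open>h\<close> into \<open>b - a\<close> in the bound on the norm.
\<close>

section \<open>The explicit Green function\<close>

definition resistance :: "(nat \<Rightarrow> real) \<Rightarrow> nat \<Rightarrow> real" where
  "resistance \<beta> i = (\<Sum>k<i. 1 / \<beta> k)"

text \<open>
  This is \<open>h\<^sup>-\<^sup>2 * G\<close>, in grid point numbering so that it also has the boundary
  values at \<open>0\<close> and \<open>n + 1\<close>.
\<close>
definition green :: "nat \<Rightarrow> (nat \<Rightarrow> real) \<Rightarrow> nat \<Rightarrow> nat \<Rightarrow> real" where
  "green n \<beta> i j = resistance \<beta> (min i j)
     * (resistance \<beta> (n + 1) - resistance \<beta> (max i j)) / resistance \<beta> (n + 1)"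

lemma resistance_0 [simp]: "resistance \<beta> 0 = 0"
  by (simp add: resistance_def)

lemma resistance_Suc: "resistance \<beta> (Suc k) = resistance \<beta> k + 1 / \<beta> k"
  by (simp add: resistance_def)

lemma green_commute: "green n \<beta> i j = green n \<beta> j i"
  by (simp add: green_def min.commute max.commute)

lemma green_boundary [simp]:
  "green n \<beta> 0 j = 0"
  "j \<le> n + 1 \<Longrightarrow> green n \<beta> (n + 1) j = 0"
  by (simp_all add: green_def max_absorb1)

section \<open>Positivity and size\<close>

lemma resistance_strict_mono:
  assumes "\<forall>k\<in>{0..n}. 0 < \<beta> k" "i < j" "j \<le> n + 1"
  shows "resistance \<beta> i < resistance \<beta> j"
  unfolding resistance_def using assms
  by (intro sum_strict_mono2[where b = i]) (auto intro: less_imp_le)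

lemma resistance_mono:
  assumes "\<forall>k\<in>{0..n}. 0 < \<beta> k" "i \<le> j" "j \<le> n + 1"
  shows "resistance \<beta> i \<le> resistance \<beta> j"
  using assms resistance_strict_mono[of n \<beta> i j] by (cases "i = j") auto

lemma resistance_nonneg:
  assumes "\<forall>k\<in>{0..n}. 0 < \<beta> k" "i \<le> n + 1"
  shows "0 \<le> resistance \<beta> i"
  using resistance_mono[OF assms(1), of 0 i] assms(2) by simp

lemma resistance_total_pos:
  assumes "\<forall>k\<in>{0..n}. 0 < \<beta> k"
  shows "0 < resistance \<beta> (n + 1)"
  using resistance_strict_mono[OF assms, of 0 "n + 1"] by simp

lemma beta_min_le: "k \<le> n \<Longrightarrow> beta_min n \<beta> \<le> \<beta> k"
  unfolding beta_min_def by (intro Min_le) auto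

lemma beta_min_pos:
  assumes "\<forall>k\<in>{0..n}. 0 < \<beta> k"
  shows "0 < beta_min n \<beta>"
  unfolding beta_min_def using assms by (subst Min_gr_iff) auto

lemma inverse_beta_le:
  assumes "\<forall>k\<in>{0..n}. 0 < \<beta> k" "k \<le> n"
  shows "1 / \<beta> k \<le> 1 / beta_min n \<beta>"
  using beta_min_pos[OF assms(1)] beta_min_le[OF assms(2)] by (intro frac_le) auto

lemma resistance_total_le:
  assumes "\<forall>k\<in>{0..n}. 0 < \<beta> k"
  shows "resistance \<beta> (n + 1) \<le> (real n + 1) / beta_min n \<beta>"
proof -
  have "resistance \<beta> (n + 1) \<le> (\<Sum>k<n + 1. 1 / beta_min n \<beta>)"
    unfolding resistance_def using inverse_beta_le[OF assms] by (intro sum_mono) auto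
  also have "\<dots> = (real n + 1) / beta_min n \<beta>" by (simp add: add.commute)
  finally show ?thesis .
qed

lemma green_pos:
  assumes "\<forall>k\<in>{0..n}. 0 < \<beta> k" "i \<in> {1..n}" "j \<in> {1..n}"
  shows "0 < green n \<beta> i j"
  unfolding green_def using assms
    resistance_strict_mono[OF assms(1), of 0 "min i j"]
    resistance_strict_mono[OF assms(1), of "max i j" "n + 1"]
    resistance_total_pos[OF assms(1)]
  by (intro divide_pos_pos mult_pos_pos) auto

text \<open>
  Enlarging the first factor from \<open>S (min i j)\<close> to \<open>S (max i j)\<close> leaves the product of two numbers
  with sum \<open>T\<close>, which is at most \<open>T\<^sup>2 / 4\<close>.
\<close>
lemma green_le_quarter:
  assumes "\<forall>k\<in>{0..n}. 0 < \<beta> k" "i \<le> n + 1" "j \<le> n + 1"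
  shows "green n \<beta> i j \<le> resistance \<beta> (n + 1) / 4"
proof -
  define T where "T = resistance \<beta> (n + 1)"
  define s where "s = resistance \<beta> (max i j)"
  have T: "0 < T" and sT: "s \<le> T"
    unfolding T_def s_def using resistance_total_pos resistance_mono assms by auto
  have "resistance \<beta> (min i j) \<le> s"
    unfolding s_def using assms by (intro resistance_mono) auto
  then have "resistance \<beta> (min i j) * (T - s) \<le> s * (T - s)"
    using sT by (intro mult_right_mono) auto
  also have "\<dots> \<le> T / 4 * T"
    using zero_le_power2[of "T - 2 * s"] by (simp add: power2_eq_square algebra_simps)
  finally show ?thesis
    unfolding green_def T_def[symmetric] s_def[symmetric] using T by (simp add: divide_le_eq)
qed

section \<open>Fluxes and increments\<close>

text \<open>
  On either side of \<open>j\<close> the function \<open>green\<close> is affine in the resistance, and across the face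
  \<open>k\<close> the resistance grows by \<open>1 / \<beta> k\<close>, which cancels the factor \<open>\<beta> k\<close>.
\<close>
lemma green_flux:
  assumes "\<forall>k\<in>{0..n}. 0 < \<beta> k" "k \<le> n"
  shows "\<beta> k * (green n \<beta> (Suc k) j - green n \<beta> k j)
    = (if k < j then 1 else 0) - resistance \<beta> j / resistance \<beta> (n + 1)"
proof -
  have T: "resistance \<beta> (n + 1) \<noteq> 0" using resistance_total_pos[OF assms(1)] by simp
  have b: "\<beta> k \<noteq> 0" using assms by force
  show ?thesis
  proof (cases "k < j")
    case True
    then have "green n \<beta> (Suc k) j - green n \<beta> k j
        = 1 / \<beta> k * (1 - resistance \<beta> j / resistance \<beta> (n + 1))"
      using T b by (simp add: green_def min_def max_def resistance_Suc[of \<beta> k] field_simps)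
    then show ?thesis using True b by simp
  next
    case False
    then have "green n \<beta> (Suc k) j - green n \<beta> k j
        = - (1 / \<beta> k * (resistance \<beta> j / resistance \<beta> (n + 1)))"
      using T b by (simp add: green_def min_def max_def resistance_Suc[of \<beta> k] field_simps)
    then show ?thesis using False b by simp
  qed
qed

lemma green_increment_le:
  assumes "\<forall>k\<in>{0..n}. 0 < \<beta> k" "k \<le> n" "j \<le> n + 1"
  shows "\<bar>green n \<beta> (Suc k) j - green n \<beta> k j\<bar> \<le> 1 / beta_min n \<beta>"
proof -
  have b: "0 < \<beta> k" using assms by auto
  have "0 \<le> resistance \<beta> j / resistance \<beta> (n + 1)" "resistance \<beta> j / resistance \<beta> (n + 1) \<le> 1"
    using resistance_total_pos[OF assms(1)] resistance_nonneg[OF assms(1,3)]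
      resistance_mono[OF assms(1,3)] by auto
  then have "\<bar>\<beta> k * (green n \<beta> (Suc k) j - green n \<beta> k j)\<bar> \<le> 1"
    unfolding green_flux[OF assms(1,2)] by auto
  then have "\<bar>green n \<beta> (Suc k) j - green n \<beta> k j\<bar> \<le> 1 / \<beta> k"
    using b by (simp add: abs_mult pos_le_divide_eq mult.commute)
  also have "\<dots> \<le> 1 / beta_min n \<beta>" using assms by (intro inverse_beta_le)
  finally show ?thesis .
qed

text \<open>The left-hand side is the drop of the flux from the face \<open>i - 1/2\<close> to the face \<open>i + 1/2\<close>.\<close>
lemma green_equation:
  assumes "\<forall>k\<in>{0..n}. 0 < \<beta> k" "1 \<le> i" "i \<le> n"
  shows "- \<beta> (i - 1) * green n \<beta> (i - 1) j + (\<beta> (i - 1) + \<beta> i) * green n \<beta> i j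
      - \<beta> i * green n \<beta> (i + 1) j = (if i = j then 1 else 0)"
proof -
  obtain m where m: "i = Suc m" using assms(2) by (cases i) auto
  have "\<beta> m * (green n \<beta> i j - green n \<beta> m j) - \<beta> i * (green n \<beta> (i + 1) j - green n \<beta> i j)
      = (if m < j then 1 else 0) - (if i < j then 1 else 0)"
    using green_flux[OF assms(1), of m j] green_flux[OF assms(1), of i j] assms(3) m by simp
  also have "\<dots> = (if i = j then 1 else 0)" using m by auto
  finally show ?thesis using m by (simp add: algebra_simps)
qed

section \<open>The inverse matrix\<close>

definition green_mat :: "nat \<Rightarrow> (nat \<Rightarrow> real) \<Rightarrow> real mat" where
  "green_mat n \<beta> = mat n n (\<lambda>(r, c). green n \<beta> (r + 1) (c + 1))"

lemma A_mat_green_mat: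
  assumes "\<forall>k\<in>{0..n}. 0 < \<beta> k"
  shows "A_mat n \<beta> * green_mat n \<beta> = 1\<^sub>m n"
proof (rule eq_matI)
  fix r c
  assume "r < dim_row (1\<^sub>m n :: real mat)" "c < dim_col (1\<^sub>m n :: real mat)"
  then have rc: "r < n" "c < n" by auto
  define U where "U k = green n \<beta> k (c + 1)" for k
  have "(A_mat n \<beta> * green_mat n \<beta>) $$ (r, c) = (A_mat n \<beta> *\<^sub>v vec n (\<lambda>k. U (k + 1))) $ (r + 1 - 1)"
    using rc by (simp add: A_mat_def green_mat_def scalar_prod_def U_def)
  also have "\<dots> = (if r + 1 = c + 1 then 1 else 0)"
    using rc green_equation[OF assms, of "r + 1" "c + 1"] green_boundary
    by (subst A_mat_action) (auto simp: U_def)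
  finally show "(A_mat n \<beta> * green_mat n \<beta>) $$ (r, c) = 1\<^sub>m n $$ (r, c)" using rc by simp
qed (auto simp: A_mat_def green_mat_def)

lemma mat_inverse_eqI:
  fixes M N :: "real mat"
  assumes M: "M \<in> carrier_mat n n" and N: "N \<in> carrier_mat n n" and MN: "M * N = 1\<^sub>m n"
  shows "invertible_mat M" "the (mat_inverse M) = N"
proof -
  have NM: "N * M = 1\<^sub>m n" by (rule mat_mult_left_right_inverse[OF M N MN])
  show "invertible_mat M"
    using M N MN NM unfolding invertible_mat_def inverts_mat_def
    by (intro conjI exI[of _ N]) auto
  have "M \<in> Units (ring_mat TYPE(real) n ())"
    using M N MN NM unfolding Units_def ring_mat_def by auto
  then obtain B where B: "mat_inverse M = Some B"
    using mat_inverse(1)[OF M] by fastforce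
  then have BM: "B * M = 1\<^sub>m n" and Bc: "B \<in> carrier_mat n n"
    using mat_inverse(2)[OF M B] by auto
  have "B = B * (M * N)" using MN Bc by simp
  also have "\<dots> = N" using assoc_mult_mat[OF Bc M N] BM N by simp
  finally show "the (mat_inverse M) = N" using B by simp
qed

lemma mesh_pos: "a < b \<Longrightarrow> 0 < mesh a b n"
  by (simp add: mesh_def)

lemma L_inv_green:
  assumes "a < b" "\<forall>k\<in>{0..n}. 0 < \<beta> k"
  shows "invertible_mat (L_mat a b n \<beta>)"
    and "L_inv a b n \<beta> = (mesh a b n)\<^sup>2 \<cdot>\<^sub>m green_mat n \<beta>"
proof -
  let ?h = "mesh a b n"
  have A: "A_mat n \<beta> \<in> carrier_mat n n" and g: "green_mat n \<beta> \<in> carrier_mat n n"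
    by (auto simp: A_mat_def green_mat_def)
  have "(1 / ?h\<^sup>2 \<cdot>\<^sub>m A_mat n \<beta>) * (?h\<^sup>2 \<cdot>\<^sub>m green_mat n \<beta>)
      = (1 / ?h\<^sup>2 * ?h\<^sup>2) \<cdot>\<^sub>m (A_mat n \<beta> * green_mat n \<beta>)"
    using A g by (intro eq_matI) auto
  then have "L_mat a b n \<beta> * (?h\<^sup>2 \<cdot>\<^sub>m green_mat n \<beta>) = 1\<^sub>m n"
    using mesh_pos[OF assms(1), of n] A_mat_green_mat[OF assms(2)]
    by (auto simp: L_mat_def)
  with A g show "invertible_mat (L_mat a b n \<beta>)"
    and "L_inv a b n \<beta> = ?h\<^sup>2 \<cdot>\<^sub>m green_mat n \<beta>"
    unfolding L_inv_def
    using mat_inverse_eqI[of "L_mat a b n \<beta>" n "?h\<^sup>2 \<cdot>\<^sub>m green_mat n \<beta>"]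
    by (auto simp: L_mat_def)
qed

lemma G_entry_green:
  assumes "a < b" "\<forall>k\<in>{0..n}. 0 < \<beta> k" "i \<in> {1..n}" "j \<in> {1..n}"
  shows "G_entry a b n \<beta> i j = (mesh a b n)\<^sup>2 * green n \<beta> i j"
proof -
  have "i - 1 < n" "j - 1 < n" using assms(3,4) by auto
  then show ?thesis
    using assms(3,4) by (simp add: G_entry_def L_inv_green(2)[OF assms(1,2)] green_mat_def)
qed

section \<open>Estimates in the mesh width\<close>

text \<open>One power of \<open>h\<close> is absorbed by \<open>T \<le> (n + 1) / beta_min\<close>, as \<open>h * (n + 1) = b - a\<close>.\<close>
lemma scaled_green_le:
  assumes "a < b" "\<forall>k\<in>{0..n}. 0 < \<beta> k" "i \<le> n + 1" "j \<le> n + 1"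
  shows "(mesh a b n)\<^sup>2 * green n \<beta> i j \<le> (b - a) / (4 * beta_min n \<beta>) * mesh a b n"
proof -
  have "green n \<beta> i j \<le> ((real n + 1) / beta_min n \<beta>) / 4"
    using green_le_quarter[OF assms(2-4)] resistance_total_le[OF assms(2)] by simp
  then have "(mesh a b n)\<^sup>2 * green n \<beta> i j
      \<le> (mesh a b n)\<^sup>2 * (((real n + 1) / beta_min n \<beta>) / 4)"
    by (intro mult_left_mono) auto
  also have "\<dots> = (mesh a b n * (real n + 1)) / (4 * beta_min n \<beta>) * mesh a b n"
    by (simp add: power2_eq_square mult_ac)
  also have "mesh a b n * (real n + 1) = b - a"
    by (simp add: mesh_def)
  finally show ?thesis .
qed

lemma mat_inf_norm_L_inv_le:
  assumes "a < b" "1 \<le> n" "\<forall>k\<in>{0..n}. 0 < \<beta> k"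
  shows "mat_inf_norm (L_inv a b n \<beta>) \<le> (b - a)\<^sup>2 / (4 * beta_min n \<beta>)"
proof -
  let ?M = "L_inv a b n \<beta>"
  have M: "?M \<in> carrier_mat n n"
    by (simp add: L_inv_green(2)[OF assms(1,3)] green_mat_def)
  have c: "0 \<le> (b - a) / (4 * beta_min n \<beta>)"
    using assms(1) beta_min_pos[OF assms(3)] by simp
  have row: "(\<Sum>j = 0..<n. \<bar>?M $$ (i, j)\<bar>) \<le> (b - a)\<^sup>2 / (4 * beta_min n \<beta>)" if i: "i < n" for i
  proof -
    have "(\<Sum>j = 0..<n. \<bar>?M $$ (i, j)\<bar>)
        \<le> (\<Sum>j = 0..<n. (b - a) / (4 * beta_min n \<beta>) * mesh a b n)"
    proof (rule sum_mono)
      fix j assume j: "j \<in> {0..<n}"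
      have "?M $$ (i, j) = (mesh a b n)\<^sup>2 * green n \<beta> (i + 1) (j + 1)"
        using i j by (simp add: L_inv_green(2)[OF assms(1,3)] green_mat_def)
      moreover have "0 < green n \<beta> (i + 1) (j + 1)"
        using i j by (intro green_pos[OF assms(3)]) auto
      ultimately show "\<bar>?M $$ (i, j)\<bar> \<le> (b - a) / (4 * beta_min n \<beta>) * mesh a b n"
        using scaled_green_le[OF assms(1,3), of "i + 1" "j + 1"] i j by (simp add: abs_mult)
    qed
    also have "\<dots> = (b - a) / (4 * beta_min n \<beta>) * (real n * mesh a b n)" by simp
    also have "\<dots> \<le> (b - a) / (4 * beta_min n \<beta>) * (b - a)"
      using assms(1) by (intro mult_left_mono[OF _ c]) (simp add: mesh_def field_simps)
    finally show ?thesis by (simp add: power2_eq_square)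
  qed
  show ?thesis
    using assms(2) row
    by (subst mat_inf_norm_row_sum[OF M]) (auto intro!: Max.boundedI)
qed

theorem corollary2p3:
  shows "\<exists>C :: real \<Rightarrow> real \<Rightarrow> real.
    \<forall>(a :: real) (b :: real) (n :: nat) (\<beta> :: nat \<Rightarrow> real).
      a < b \<longrightarrow> 1 \<le> n \<longrightarrow> (\<forall>i\<in>{0..n}. 0 < \<beta> i) \<longrightarrow>
        invertible_mat (L_mat a b n \<beta>) \<and>
        (\<forall>i\<in>{1..n}. \<forall>j\<in>{1..n}.
          0 < G_entry a b n \<beta> i j \<and>
          G_entry a b n \<beta> i j \<le> C (b - a) (beta_min n \<beta>) * mesh a b n) \<and>
        (\<forall>i\<in>{1..n - 1}. \<forall>j\<in>{1..n}.
          \<bar>G_entry a b n \<beta> (i + 1) j - G_entry a b n \<beta> i j\<bar>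
            \<le> (mesh a b n)\<^sup>2 / beta_min n \<beta>) \<and>
        (\<forall>i\<in>{1..n}. \<forall>j\<in>{1..n - 1}.
          \<bar>G_entry a b n \<beta> i (j + 1) - G_entry a b n \<beta> i j\<bar>
            \<le> (mesh a b n)\<^sup>2 / beta_min n \<beta>) \<and>
        mat_inf_norm (L_inv a b n \<beta>) \<le> (b - a)\<^sup>2 / (4 * beta_min n \<beta>)"
proof (intro exI[of _ "\<lambda>d m. d / (4 * m)"] allI impI)
  fix a b :: real and n :: nat and \<beta> :: "nat \<Rightarrow> real"
  assume ab: "a < b" and n: "1 \<le> n" and pos: "\<forall>i\<in>{0..n}. 0 < \<beta> i"
  let ?h = "mesh a b n" and ?G = "G_entry a b n \<beta>"
  note G = G_entry_green[OF ab pos]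
  have h: "0 < ?h" by (rule mesh_pos[OF ab])
  have incr: "\<bar>?h\<^sup>2 * green n \<beta> (i + 1) j - ?h\<^sup>2 * green n \<beta> i j\<bar> \<le> ?h\<^sup>2 / beta_min n \<beta>"
    if "i \<le> n" "j \<le> n" for i j
    using mult_left_mono[OF green_increment_le[OF pos, of i j], of "?h\<^sup>2"] that
    by (simp add: right_diff_distrib[symmetric] abs_mult)
  have entry: "0 < ?G i j \<and> ?G i j \<le> (b - a) / (4 * beta_min n \<beta>) * ?h"
    if "i \<in> {1..n}" "j \<in> {1..n}" for i j
    using that h green_pos[OF pos that] scaled_green_le[OF ab pos, of i j] by (simp add: G)
  have incr1: "\<bar>?G (i + 1) j - ?G i j\<bar> \<le> ?h\<^sup>2 / beta_min n \<beta>"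
    if "i \<in> {1..n - 1}" "j \<in> {1..n}" for i j
  proof -
    have "i \<in> {1..n}" "i + 1 \<in> {1..n}" using that n by auto
    then show ?thesis using that incr[of i j] by (simp only: G) simp
  qed
  have incr2: "\<bar>?G i (j + 1) - ?G i j\<bar> \<le> ?h\<^sup>2 / beta_min n \<beta>"
    if "i \<in> {1..n}" "j \<in> {1..n - 1}" for i j
  proof -
    have "j \<in> {1..n}" "j + 1 \<in> {1..n}" using that n by auto
    then have "?G i (j + 1) = ?G (j + 1) i" "?G i j = ?G j i"
      using that green_commute[of n \<beta> i] by (simp_all only: G)
    then show ?thesis using incr1[OF that(2,1)] by simp
  qed
  show "invertible_mat (L_mat a b n \<beta>) \<and>
      (\<forall>i\<in>{1..n}. \<forall>j\<in>{1..n}.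
        0 < ?G i j \<and> ?G i j \<le> (b - a) / (4 * beta_min n \<beta>) * ?h) \<and>
      (\<forall>i\<in>{1..n - 1}. \<forall>j\<in>{1..n}. \<bar>?G (i + 1) j - ?G i j\<bar> \<le> ?h\<^sup>2 / beta_min n \<beta>) \<and>
      (\<forall>i\<in>{1..n}. \<forall>j\<in>{1..n - 1}. \<bar>?G i (j + 1) - ?G i j\<bar> \<le> ?h\<^sup>2 / beta_min n \<beta>) \<and>
      mat_inf_norm (L_inv a b n \<beta>) \<le> (b - a)\<^sup>2 / (4 * beta_min n \<beta>)"
    using L_inv_green(1)[OF ab pos] entry incr1 incr2 mat_inf_norm_L_inv_le[OF ab n pos] by blast
qed

end
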